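(* Let $n_1,n_2,n_3\in\mathbb{N}_0$, let $\alpha,\beta,\gamma,\delta,a,b,\phi,\theta,\eta,\xi$ be real parameters, and put $e=\alpha+\beta+\gamma+\delta+a+b$. Assume that no denominator occurring below (including those in the terminating ${}_3F_2$ sums) vanishes. Then $$P_{n_1,n_2,n_3}^{(\alpha,\beta,\gamma,\delta,a,b)}(x,y,z)=\sum_{k_1=0}^{n_1}\sum_{k_2=0}^{n_2}\sum_{k_3=0}^{n_3}C_{k_1,k_2,k_3}\,F^{(1)}_{k_1,k_2,k_3}F^{(2)}_{k_2,k_3}F^{(3)}_{k_3}\,(1-x)^{n_2-k_2}(1-x-y)^{n_3-k_3}\,P_{k_1,k_2,k_3}^{(\phi,\theta,\eta,\xi,a,b)}(x,y,z),$$ where $$\begin{aligned}C_{k_1,k_2,k_3}={}&\frac{(k_1+2n_2+2n_3+\beta+\gamma+\delta+a+b+3)_{n_1-k_1}\,(n_1+2n_2+2n_3+e+3)_{k_1}}{(n_1-k_1)!\,(n_2-k_2)!\,(n_3-k_3)!\,(k_1+2k_2+2k_3+\phi+\theta+\xi+\eta+a+b+3)_{k_1}}\\&\times\frac{(k_2+2n_3+\gamma+\delta+b+2)_{n_2-k_2}\,(n_2+2n_3+\beta+\gamma+\delta+b+2)_{k_2}\,(k_3+\delta+1)_{n_3-k_3}\,(n_3+\gamma+\delta+1)_{k_3}}{(k_2+2k_3+\theta+\xi+\eta+b+2)_{k_2}\,(k_3+\xi+\eta+1)_{k_3}},\end{aligned}$$ $$F^{(1)}_{k_1,k_2,k_3}={}_3F_2\!\left(\begin{array}{c}k_1-n_1,\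 n_1+2n_2+2n_3+k_1+e+3,\ k_1+2k_2+2k_3+\theta+\xi+\eta+a+b+3\\ 2k_1+2k_2+2k_3+\phi+\theta+\xi+\eta+a+b+4,\ k_1+2n_2+2n_3+\beta+\gamma+\delta+a+b+3\end{array}\Big|\,1\right),$$ $$F^{(2)}_{k_2,k_3}={}_3F_2\!\left(\begin{array}{c}k_2-n_2,\ n_2+2n_3+k_2+\beta+\gamma+\delta+b+2,\ k_2+2k_3+\xi+\eta+b+2\\ 2k_2+2k_3+\theta+\xi+\eta+b+3,\ k_2+2n_3+\gamma+\delta+b+2\end{array}\Big|\,1\right),$$ $$F^{(3)}_{k_3}={}_3F_2\!\left(\begin{array}{c}k_3-n_3,\ n_3+k_3+\gamma+\delta+1,\ k_3+\xi+1\\ 2k_3+\xi+\eta+2,\ k_3+\delta+1\end{array}\Big|\,1\right).$$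
   Context: Jacobi polynomials: for $n\in\mathbb{N}_0=\{0,1,2,\dots\}$ and real $p,q$, $$P_n^{(p,q)}(t)=\frac{(-1)^n}{2^n n!}(1-t)^{-p}(1+t)^{-q}\frac{d^n}{dt^n}\left\{(1-t)^{n+p}(1+t)^{n+q}\right\}$$ (a polynomial in $t$). Points $(x,y,z)$ range over the simplex $\mathbb{T}^3=\{(x,y,z)\in\mathbb{R}^3: x,y,z>0,\ 1-x-y-z>0\}$. Six-parameter polynomials: for $n_1,n_2,n_3\in\mathbb{N}_0$, $$P_{n_1,n_2,n_3}^{(\alpha,\beta,\gamma,\delta,a,b)}(x,y,z)=P_{n_1}^{(\beta+\gamma+\delta+a+b+2n_2+2n_3+2,\,\alpha)}(2x-1)\,(1-x)^{n_2}\,P_{n_2}^{(\gamma+\delta+2n_3+b+1,\,\beta)}\!\left(\tfrac{2y}{1-x}-1\right)(1-x-y)^{n_3}\,P_{n_3}^{(\delta,\gamma)}\!\left(\tfrac{2z}{1-x-y}-1\right).$$ Pochhammer symbol: $(\lambda)_0=1$ and $(\lambda)_m=\lambda(\lambda+1)\cdots(\lambda+m-1)$ for $m\ge1$. Hypergeometric notation: for $N\in\mathbb{N}_0$, $${}_3F_2\!\left(\begin{array}{c}-N,\ p,\ q\\ r,\ s\end{array}\Big|\,1\right)=\sum_{j=0}^{N}\frac{(-N)_j(p)_j(q)_j}{(r)_j(s)_j\,j!}.$$ *)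

theory Defs
  imports "HOL-Analysis.Analysis"
begin

(* Rodrigues' formula.  With real exponents it is meaningful for -1 < t < 1 only; there it
   coincides with the Jacobi polynomial for all real p and q.  On the simplex below, every
   argument at which it is used lies in this interval. *)
definition jacobi :: "nat \<Rightarrow> real \<Rightarrow> real \<Rightarrow> real \<Rightarrow> real" where
  "jacobi n p q t =
     (-1) ^ n / (2 ^ n * fact n) * (1 - t) powr (-p) * (1 + t) powr (-q) *
     (deriv ^^ n) (\<lambda>u. (1 - u) powr (real n + p) * (1 + u) powr (real n + q)) t"

definition simplex3 :: "(real \<times> real \<times> real) set" where
  "simplex3 = {(x, y, z). 0 < x \<and> 0 < y \<and> 0 < z \<and> 0 < 1 - x - y - z}"

definition simplex_poly ::
  "nat \<Rightarrow> nat \<Rightarrow> nat \<Rightarrow> real \<Rightarrow> real \<Rightarrow> real \<Rightarrow> real \<Rightarrow> real \<Rightarrow> real \<Rightarrow> real \<Rightarrow> real \<Rightarrow> real \<Rightarrow> real" where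
  "simplex_poly n1 n2 n3 \<alpha> \<beta> \<gamma> \<delta> a b x y z =
     jacobi n1 (\<beta> + \<gamma> + \<delta> + a + b + 2 * real n2 + 2 * real n3 + 2) \<alpha> (2 * x - 1) *
     (1 - x) ^ n2 *
     jacobi n2 (\<gamma> + \<delta> + 2 * real n3 + b + 1) \<beta> (2 * y / (1 - x) - 1) *
     (1 - x - y) ^ n3 *
     jacobi n3 \<delta> \<gamma> (2 * z / (1 - x - y) - 1)"

(* The terminating series 3F2(-N, p, q; r, s; 1).  The truncation at N is part of the
   definition: r or s may be a nonpositive integer below -N + 1. *)
definition hyp3F2 :: "nat \<Rightarrow> real \<Rightarrow> real \<Rightarrow> real \<Rightarrow> real \<Rightarrow> real" where
  "hyp3F2 N p q r s =
     (\<Sum>j = 0..N. pochhammer (- real N) j * pochhammer p j * pochhammer q j /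
        (pochhammer r j * pochhammer s j * fact j))"

end

theory Submission
  imports Defs
begin

text \<open>
  The identity is a one-variable statement applied three times. The connection formula for Jacobi
  polynomials (jacobi_connection) expands \<open>P_n^(p,q)\<close> in the
  polynomials \<open>P_k^(p',q')\<close>, where old and new parameters are unrelated, with a
  terminating \<open>3F2\<close> in each coefficient. The first Jacobi factor on the right-hand side has a
  parameter that depends on \<open>k2\<close> and \<open>k3\<close>, the second one a parameter that
  depends on \<open>k3\<close>. The powers \<open>(1 - x)^(n2 - k2)\<close> and
  \<open>(1 - x - y)^(n3 - k3)\<close> complete those inside the right-hand polynomial to
  \<open>(1 - x)^n2\<close> and \<open>(1 - x - y)^n3\<close>, so they leave the sums. For fixed
  \<open>k2\<close>, \<open>k3\<close> the sum over \<open>k1\<close> is then a connection formula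
  whose value does not depend on \<open>k2\<close> and \<open>k3\<close>; the sum over
  \<open>k2\<close> collapses next, and the one over \<open>k3\<close> last.

  The connection formula is proved by passing through powers of \<open>v = (1 - t) / 2\<close>.
  Rodrigues' formula, Leibniz' rule and Vandermonde's identity give the expansion of
  \<open>P_n^(p,q)\<close> in powers of \<open>v\<close> (jacobi_expansion); conversely
  \<open>v^j\<close> is an explicit combination of \<open>P_k^(p',q')\<close> with
  \<open>k \<le> j\<close> (power_eq_sum_jacobi), because the matrix product of the two expansions
  reduces to an alternating sum that telescopes (alternating_pochhammer_sum_eq_0). Substituting the
  second expansion into the first leaves, as coefficient of \<open>P_k^(p',q')\<close>, a sum over
  \<open>j - k\<close> whose terms are those of the \<open>3F2\<close>.

  The coefficients in powers of \<open>v\<close> contain \<open>(p + j + 1)_(n - j)\<close> in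
  place of the customary quotient \<open>(p + 1)_n / (p + 1)_j\<close>, so that the expansion holds
  for all real \<open>p\<close>, negative integers included.
\<close>

section \<open>Jacobi polynomials in powers of (1 - t) / 2\<close>

lemma sum_triangle_swap:
  fixes f :: "nat \<Rightarrow> nat \<Rightarrow> real"
  shows "(\<Sum>k\<le>n. \<Sum>i\<le>k. f k i) = (\<Sum>i\<le>n. \<Sum>l\<le>n - i. f (i + l) i)"
  unfolding sum.Sigma[OF finite_atMost ballI[OF finite_atMost]]
  by (rule sum.reindex_bij_witness[of _ "\<lambda>(i, l). (i + l, i)" "\<lambda>(k, i). (i, k - i)"]) auto

text \<open>
  Leibniz' rule for real functions whose iterated derivatives \<open>F i\<close>,
  \<open>G i\<close> are known in closed form on an open set; outside that set nothing is known,
  hence the passage through a neighbourhood filter in the induction step.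
\<close>
lemma higher_deriv_mult_chain:
  fixes F G :: "nat \<Rightarrow> real \<Rightarrow> real"
  assumes S: "open S"
    and F: "\<And>i t. t \<in> S \<Longrightarrow> (F i has_real_derivative F (Suc i) t) (at t)"
    and G: "\<And>i t. t \<in> S \<Longrightarrow> (G i has_real_derivative G (Suc i) t) (at t)"
    and t: "t \<in> S"
  shows "(deriv ^^ n) (\<lambda>u. F 0 u * G 0 u) t = (\<Sum>k\<le>n. real (n choose k) * F k t * G (n - k) t)"
  using t
proof (induction n arbitrary: t)
  case 0
  then show ?case by simp
next
  case (Suc n)
  have "eventually (\<lambda>u. (deriv ^^ n) (\<lambda>u. F 0 u * G 0 u) u =
      (\<Sum>k\<le>n. real (n choose k) * F k u * G (n - k) u)) (nhds t)"
    using eventually_nhds_in_open[OF S Suc.prems] by eventually_elim (rule Suc.IH)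
  then have "(deriv ^^ Suc n) (\<lambda>u. F 0 u * G 0 u) t =
      deriv (\<lambda>u. \<Sum>k\<le>n. real (n choose k) * F k u * G (n - k) u) t"
    by (simp add: deriv_cong_ev)
  also have "\<dots> = (\<Sum>k\<le>n. real (n choose k) * (F (Suc k) t * G (n - k) t + F k t * G (Suc (n - k)) t))"
    by (rule DERIV_imp_deriv)
       (auto intro!: derivative_eq_intros F[OF Suc.prems] G[OF Suc.prems] sum.cong simp: algebra_simps)
  also have "\<dots> = (\<Sum>k\<le>n. real (n choose k) * F (Suc k) t * G (n - k) t) +
      (\<Sum>k\<le>n. real (n choose k) * F k t * G (Suc (n - k)) t)"
    by (simp add: algebra_simps sum.distrib)
  also have "(\<Sum>k\<le>n. real (n choose k) * F k t * G (Suc (n - k)) t) =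
      (\<Sum>k\<le>Suc n. real (n choose k) * F k t * G (Suc n - k) t)"
    by (simp add: Suc_diff_le)
  also have "\<dots> = F 0 t * G (Suc n) t +
      (\<Sum>k\<le>n. real (n choose Suc k) * F (Suc k) t * G (n - k) t)"
    by (subst sum.atMost_Suc_shift) simp
  also have "(\<Sum>k\<le>n. real (n choose k) * F (Suc k) t * G (n - k) t) +
      (F 0 t * G (Suc n) t + (\<Sum>k\<le>n. real (n choose Suc k) * F (Suc k) t * G (n - k) t)) =
      F 0 t * G (Suc n) t + (\<Sum>k\<le>n. real (Suc n choose Suc k) * F (Suc k) t * G (n - k) t)"
    by (simp add: algebra_simps sum.distrib)
  also have "\<dots> = (\<Sum>k\<le>Suc n. real (Suc n choose k) * F k t * G (Suc n - k) t)"
    by (subst sum.atMost_Suc_shift) simp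
  finally show ?case .
qed

lemma fact_gbinomial_Suc:
  "fact (Suc i) * ((A::real) gchoose Suc i) = (A - real i) * (fact i * (A gchoose i))"
  using gbinomial_mult_fact[of "Suc i" A] gbinomial_mult_fact[of i A]
  by (simp del: fact_Suc)

text \<open>
  Leibniz' rule in Rodrigues' formula: the real powers of \<open>1 - t\<close> and
  \<open>1 + t\<close> that remain after differentiation cancel against the prefactor up to
  natural powers.
\<close>
lemma jacobi_Rodrigues_sum:
  assumes "-1 < t" "t < 1"
  shows "jacobi n p q t = (\<Sum>k\<le>n. ((real n + p) gchoose k) * ((real n + q) gchoose (n - k)) *
    ((t - 1) / 2) ^ (n - k) * ((t + 1) / 2) ^ k)"
proof -
  define A where "A = real n + p"
  define B where "B = real n + q"
  define F where "F i u = (-1) ^ i * (fact i * (A gchoose i)) * (1 - u) powr (A - real i)" for i u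
  define G where "G i u = fact i * (B gchoose i) * (1 + u) powr (B - real i)" for i u
  have F: "(F i has_real_derivative F (Suc i) u) (at u)" if "u \<in> {-1<..<1}" for i u
    unfolding F_def fact_gbinomial_Suc using that
    by (auto intro!: derivative_eq_intros simp: algebra_simps)
  have G: "(G i has_real_derivative G (Suc i) u) (at u)" if "u \<in> {-1<..<1}" for i u
    unfolding G_def fact_gbinomial_Suc using that
    by (auto intro!: derivative_eq_intros simp: algebra_simps)
  have "(deriv ^^ n) (\<lambda>u. (1 - u) powr A * (1 + u) powr B) t =
      (deriv ^^ n) (\<lambda>u. F 0 u * G 0 u) t"
    by (simp add: F_def G_def)
  also have "\<dots> = (\<Sum>k\<le>n. real (n choose k) * F k t * G (n - k) t)"
    using assms by (intro higher_deriv_mult_chain[where S = "{-1<..<1}"] F G) auto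
  finally have D: "(deriv ^^ n) (\<lambda>u. (1 - u) powr A * (1 + u) powr B) t =
    (\<Sum>k\<le>n. real (n choose k) * F k t * G (n - k) t)" .
  have "(-1) ^ n / (2 ^ n * fact n) * (1 - t) powr (-p) * (1 + t) powr (-q) *
      (real (n choose k) * F k t * G (n - k) t) =
      (A gchoose k) * (B gchoose (n - k)) * ((t - 1) / 2) ^ (n - k) * ((t + 1) / 2) ^ k"
    if k: "k \<le> n" for k
  proof -
    have 1: "(1 - t) powr (-p) * (1 - t) powr (A - real k) = (1 - t) ^ (n - k)"
      using assms k by (simp add: A_def powr_realpow[symmetric] of_nat_diff flip: powr_add)
    have 2: "(1 + t) powr (-q) * (1 + t) powr (B - real (n - k)) = (1 + t) ^ k"
      using assms k by (simp add: B_def powr_realpow[symmetric] of_nat_diff flip: powr_add)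
    have 3: "((t - 1) / 2) ^ (n - k) = (-1) ^ (n - k) * (1 - t) ^ (n - k) / 2 ^ (n - k)"
      by (simp add: power_divide flip: power_mult_distrib)
    have 4: "(-1) ^ n = (-1::real) ^ (n - k) * (-1) ^ k" "(2::real) ^ n = 2 ^ (n - k) * 2 ^ k"
      using k by (simp_all flip: power_add)
    have 5: "real (n choose k) = fact n / (fact k * fact (n - k))"
      using k by (rule binomial_fact)
    have "(-1) ^ n / (2 ^ n * fact n) * (1 - t) powr (-p) * (1 + t) powr (-q) *
      (real (n choose k) * F k t * G (n - k) t) =
      (-1) ^ n * (-1) ^ k / 2 ^ n * (A gchoose k) * (B gchoose (n - k)) *
       ((1 - t) powr (-p) * (1 - t) powr (A - real k)) *
       ((1 + t) powr (-q) * (1 + t) powr (B - real (n - k)))"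
      unfolding 5 F_def G_def by (simp add: field_simps)
    also have "\<dots> = (A gchoose k) * (B gchoose (n - k)) * ((t - 1) / 2) ^ (n - k) * ((t + 1) / 2) ^ k"
      unfolding 1 2 3 4 by (simp add: power_divide field_simps)
    finally show ?thesis .
  qed
  then show ?thesis
    unfolding jacobi_def A_def[symmetric] B_def[symmetric] D sum_distrib_left
    by (intro sum.cong) auto
qed

text \<open>
  With \<open>w = (t - 1) / 2\<close>, the factors \<open>((t + 1) / 2)^k = (w + 1)^k\<close> are
  expanded binomially. The coefficient of \<open>w^j\<close> is then a convolution of binomial
  coefficients, which trinomial revision and Vandermonde's identity evaluate.
\<close>
lemma jacobi_expansion:
  assumes "-1 < t" "t < 1"
  shows "jacobi n p q t = (\<Sum>j\<le>n. pochhammer (p + real j + 1) (n - j) *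
    pochhammer (real n + p + q + 1) j / (fact j * fact (n - j)) * (-1) ^ j * ((1 - t) / 2) ^ j)"
proof -
  define w where "w = (t - 1) / 2"
  define A where "A = real n + p"
  define B where "B = real n + q"
  have t: "(t + 1) / 2 = w + 1" by (simp add: w_def field_simps)
  have "jacobi n p q t = (\<Sum>k\<le>n. (A gchoose k) * (B gchoose (n - k)) * w ^ (n - k) * (w + 1) ^ k)"
    unfolding jacobi_Rodrigues_sum[OF assms] t w_def A_def B_def ..
  also have "\<dots> = (\<Sum>k\<le>n. \<Sum>r\<le>k. (A gchoose k) * (B gchoose (n - k)) *
      real (k choose r) * w ^ (n - r))"
  proof (intro sum.cong refl)
    fix k assume "k \<in> {..n}"
    then have *: "w ^ (n - k) * w ^ (k - r) = w ^ (n - r)" if "r \<le> k" for r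
      using that by (simp flip: power_add)
    have "(w + 1) ^ k = (\<Sum>r\<le>k. real (k choose r) * w ^ (k - r))"
      using binomial_ring[of 1 w k] by (simp add: add.commute)
    then show "(A gchoose k) * (B gchoose (n - k)) * w ^ (n - k) * (w + 1) ^ k = 
      (\<Sum>r\<le>k. (A gchoose k) * (B gchoose (n - k)) * real (k choose r) * w ^ (n - r))"
      by (simp add: sum_distrib_left mult.assoc mult.left_commute[of "w ^ (n - k)"] *)
  qed
  also have "\<dots> = (\<Sum>r\<le>n. \<Sum>l\<le>n - r. (A gchoose (r + l)) * (B gchoose (n - (r + l))) *
      real ((r + l) choose r) * w ^ (n - r))"
    by (rule sum_triangle_swap)
  also have "\<dots> = (\<Sum>r\<le>n. (A gchoose r) * ((A - real r + B) gchoose (n - r)) * w ^ (n - r))"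
  proof (intro sum.cong refl)
    fix r assume "r \<in> {..n}"
    have "(A gchoose (r + l)) * real ((r + l) choose r) = (A gchoose r) * (A - real r gchoose l)" for l
      using gbinomial_trinomial_revision[of r "r + l" A] by (simp add: binomial_gbinomial)
    then have "(\<Sum>l\<le>n - r. (A gchoose (r + l)) * (B gchoose (n - (r + l))) *
      real ((r + l) choose r) * w ^ (n - r)) =
      (A gchoose r) * w ^ (n - r) * (\<Sum>l\<le>n - r. (A - real r gchoose l) * (B gchoose (n - r - l)))"
      unfolding sum_distrib_left by (intro sum.cong refl) (simp add: algebra_simps)
    then show "(\<Sum>l\<le>n - r. (A gchoose (r + l)) * (B gchoose (n - (r + l))) *
      real ((r + l) choose r) * w ^ (n - r)) = 
      (A gchoose r) * ((A - real r + B) gchoose (n - r)) * w ^ (n - r)"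
      using gbinomial_Vandermonde[of "A - real r" B "n - r"] by (simp add: atLeast0AtMost)
  qed
  also have "\<dots> = (\<Sum>j\<le>n. (A gchoose (n - j)) * ((A - real (n - j) + B) gchoose j) * w ^ j)"
    by (rule sum.reindex_bij_witness[of _ "\<lambda>j. n - j" "\<lambda>j. n - j"]) auto
  also have "\<dots> = (\<Sum>j\<le>n. pochhammer (p + real j + 1) (n - j) *
    pochhammer (real n + p + q + 1) j / (fact j * fact (n - j)) * (-1) ^ j * ((1 - t) / 2) ^ j)"
  proof (intro sum.cong refl)
    fix j assume "j \<in> {..n}"
    then have "A - real (n - j) + 1 = p + real j + 1" "A - real (n - j) + B - real j + 1 = real n + p + q + 1"
      by (simp_all add: A_def B_def of_nat_diff)
    moreover have "w ^ j = (-1) ^ j * ((1 - t) / 2) ^ j"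
      by (simp add: w_def flip: power_mult_distrib)
    ultimately show "(A gchoose (n - j)) * ((A - real (n - j) + B) gchoose j) * w ^ j =
      pochhammer (p + real j + 1) (n - j) *
    pochhammer (real n + p + q + 1) j / (fact j * fact (n - j)) * (-1) ^ j * ((1 - t) / 2) ^ j"
      by (simp only: gbinomial_pochhammer') (simp add: mult_ac)
  qed
  finally show ?thesis .
qed

section \<open>Powers of (1 - t) / 2 in Jacobi polynomials\<close>

lemma pochhammer_neq_0I:
  "(\<And>r. r < n \<Longrightarrow> a + real r \<noteq> 0) \<Longrightarrow> pochhammer a n \<noteq> 0"
  by (simp add: pochhammer_prod)

text \<open>
  The two Pochhammer symbols in the denominator make up \<open>(c + l)_(m + 1)\<close> with the
  factor \<open>c + 2 l\<close> left out. Where this factor is nonzero the summand is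
  \<open>(-1)^l (m choose l) (c + 2 l) / (c + l)_(m + 1)\<close>, and it is the difference of two
  consecutive values of the right-hand side because
  \<open>(m choose l) (c + 2 l) = (m - 1 choose l) (c + l) + (m - 1 choose l - 1) (c + l + m)\<close>.
  Leaving the factor out matters: \<open>c + 2 l\<close> may vanish for \<open>l = 0\<close>, so
  the induction starts from that term as it stands.
\<close>
lemma alternating_pochhammer_partial_sum:
  fixes c :: real
  assumes c: "\<And>r. 1 \<le> r \<Longrightarrow> r < 2 * m \<Longrightarrow> c + real r \<noteq> 0" and "L < m"
  shows "(\<Sum>l\<le>L. (-1) ^ l * real (m choose l) /
      (pochhammer (c + real l) l * pochhammer (c + 2 * real l + 1) (m - l))) =
    (-1) ^ L * real ((m - 1) choose L) / pochhammer (c + real L + 1) m"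
  using \<open>L < m\<close>
proof (induction L)
  case 0
  then show ?case by simp
next
  case (Suc L)
  define l where "l = Suc L"
  have l: "1 \<le> l" "l < m" using Suc.prems by (simp_all add: l_def)
  define P where "P = pochhammer (c + real l) l"
  define Q where "Q = pochhammer (c + 2 * real l + 1) (m - l)"
  \<comment> \<open>\<open>T\<close> is the common denominator of the new summand and of both partial sums.\<close>
  define T where "T = P * ((c + 2 * real l) * Q)"
  have "T = pochhammer (c + real l) (l + Suc (m - l))"
    unfolding T_def P_def Q_def pochhammer_product' by (simp add: pochhammer_rec algebra_simps)
  then have T: "T = pochhammer (c + real l) (Suc m)"
    using l by simp
  have "c + real l + real r \<noteq> 0" if "r < Suc m" for r
    using c[of "l + r"] that l by (simp add: add.assoc)
  then have "T \<noteq> 0"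
    unfolding T by (rule pochhammer_neq_0I)
  have U: "(c + real l) * pochhammer (c + real l + 1) m = T"
    unfolding T pochhammer_rec ..
  have V: "pochhammer (c + real l) m * (c + real l + real m) = T"
    unfolding T pochhammer_Suc ..
  have "real m * real ((m - 1) choose L) = real l * real (m choose l)"
    using Suc_times_binomial[of L "m - 1"] l unfolding l_def
    by (metis Suc_diff_1 Suc_times_binomial_eq mult.commute of_nat_mult less_imp_Suc_add zero_less_Suc diff_Suc_1)
  moreover have "real ((m - 1) choose L) + real ((m - 1) choose l) = real (m choose l)"
    using l unfolding l_def by (cases m) simp_all
  ultimately have bin: "real m * real ((m - 1) choose L) = real l * real (m choose l)"
    "real m * real ((m - 1) choose l) = (real m - real l) * real (m choose l)"
    by algebra+
  have "real m * (real (m choose l) * (c + 2 * real l)) =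
      real m * (real ((m - 1) choose L) * (c + real l + real m) + real ((m - 1) choose l) * (c + real l))"
    using bin by algebra
  then have key: "real (m choose l) * (c + 2 * real l) =
      real ((m - 1) choose L) * (c + real l + real m) + real ((m - 1) choose l) * (c + real l)"
    using l by simp
  have "(\<Sum>l\<le>Suc L. (-1) ^ l * real (m choose l) /
      (pochhammer (c + real l) l * pochhammer (c + 2 * real l + 1) (m - l))) =
      (-1) ^ L * real ((m - 1) choose L) / pochhammer (c + real L + 1) m +
      (-1) ^ l * real (m choose l) / (P * Q)"
    using Suc by (simp add: l_def P_def Q_def)
  also have "(-1) ^ L * real ((m - 1) choose L) / pochhammer (c + real L + 1) m =
      - ((-1) ^ l * real ((m - 1) choose L) / pochhammer (c + real l) m)"
    by (simp add: l_def add_ac)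
  also have "1 / pochhammer (c + real l) m = (c + real l + real m) / T"
    using \<open>T \<noteq> 0\<close> unfolding V[symmetric] by simp
  then have "(-1) ^ l * real ((m - 1) choose L) / pochhammer (c + real l) m =
      (-1) ^ l * real ((m - 1) choose L) * ((c + real l + real m) / T)"
    by (metis mult.right_neutral times_divide_eq_right)
  also have "(-1) ^ l * real (m choose l) / (P * Q) = (-1) ^ l * real (m choose l) * ((c + 2 * real l) / T)"
    using \<open>T \<noteq> 0\<close> by (auto simp: T_def)
  also have "- ((-1) ^ l * real ((m - 1) choose L) * ((c + real l + real m) / T)) +
      (-1) ^ l * real (m choose l) * ((c + 2 * real l) / T) =
      (-1) ^ l * ((real (m choose l) * (c + 2 * real l) -
         real ((m - 1) choose L) * (c + real l + real m)) / T)"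
    by (simp add: field_simps diff_divide_distrib)
  also have "\<dots> = (-1) ^ l * (real ((m - 1) choose l) * (c + real l) / T)"
    unfolding key by simp
  also have "(c + real l) / T = 1 / pochhammer (c + real l + 1) m"
    using \<open>T \<noteq> 0\<close> unfolding U[symmetric] by simp
  then have "(-1) ^ l * (real ((m - 1) choose l) * (c + real l) / T) =
      (-1) ^ l * real ((m - 1) choose l) / pochhammer (c + real l + 1) m"
    by (simp only: times_divide_eq_right[symmetric]) simp
  finally show ?case unfolding l_def .
qed

text \<open>
  The telescoping stops at \<open>m - 1\<close> because \<open>c + 2 m\<close> may vanish too. The
  last summand \<open>(-1)^m / (c + m)_m\<close> is the negative of the partial sum before it.
\<close>
lemma alternating_pochhammer_sum_eq_0:
  fixes c :: real
  assumes c: "\<And>r. 1 \<le> r \<Longrightarrow> r < 2 * m \<Longrightarrow> c + real r \<noteq> 0" and "m > 0"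
  shows "(\<Sum>l\<le>m. (-1) ^ l * real (m choose l) /
      (pochhammer (c + real l) l * pochhammer (c + 2 * real l + 1) (m - l))) = 0"
proof -
  obtain L where m: "m = Suc L" using \<open>m > 0\<close> by (cases m) auto
  have "(\<Sum>l\<le>L. (-1) ^ l * real (m choose l) /
      (pochhammer (c + real l) l * pochhammer (c + 2 * real l + 1) (m - l))) =
    (-1) ^ L * real ((m - 1) choose L) / pochhammer (c + real L + 1) m"
    using c m by (intro alternating_pochhammer_partial_sum) auto
  then show ?thesis
    unfolding m by (simp add: add_ac)
qed

text \<open>
  Inverse of the expansion above. After inserting that expansion, the coefficient of
  \<open>v^i\<close> becomes, with \<open>m = j - i\<close> and \<open>c = 2 i + p + q + 1\<close>, a
  multiple of the alternating sum: the products \<open>(p + i + 1)_(k - i) (p + k + 1)_(j - k)\<close>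
  do not depend on \<open>k\<close>, and
  \<open>(k + p + q + 1)_i\<close> cancels the leading factors of \<open>(k + p + q + 1)_k\<close>. The
  sum vanishes unless \<open>i = j\<close>.
\<close>
lemma power_eq_sum_jacobi:
  assumes t: "-1 < t" "t < 1"
    and pq: "\<And>s. 1 \<le> s \<Longrightarrow> s < 2 * j \<Longrightarrow> p + q + 1 + real s \<noteq> 0"
  shows "((1 - t) / 2) ^ j = (\<Sum>k\<le>j. (-1) ^ k * fact j * pochhammer (p + real k + 1) (j - k) /
    (fact (j - k) * pochhammer (real k + p + q + 1) k * pochhammer (2 * real k + p + q + 2) (j - k)) *
    jacobi k p q t)"
proof -
  define v where "v = (1 - t) / 2"
  define c where "c i = 2 * real i + p + q + 1" for i
  define f where "f k i = (-1) ^ k * fact j * pochhammer (p + real k + 1) (j - k) /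
    (fact (j - k) * pochhammer (real k + p + q + 1) k * pochhammer (2 * real k + p + q + 2) (j - k)) *
    (pochhammer (p + real i + 1) (k - i) * pochhammer (real k + p + q + 1) i /
      (fact i * fact (k - i)) * (-1) ^ i * v ^ i)" for k i
  have "(\<Sum>k\<le>j. (-1) ^ k * fact j * pochhammer (p + real k + 1) (j - k) /
    (fact (j - k) * pochhammer (real k + p + q + 1) k * pochhammer (2 * real k + p + q + 2) (j - k)) *
    jacobi k p q t) = (\<Sum>k\<le>j. \<Sum>i\<le>k. f k i)"
    unfolding jacobi_expansion[OF t] sum_distrib_left f_def v_def ..
  also have "\<dots> = (\<Sum>i\<le>j. \<Sum>l\<le>j - i. f (i + l) i)"
    by (rule sum_triangle_swap)
  also have "\<dots> = (\<Sum>i\<le>j. if i = j then v ^ j else 0)"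
  proof (intro sum.cong refl)
    fix i assume "i \<in> {..j}"
    then have i: "i \<le> j" by simp
    define m where "m = j - i"
    have "f (i + l) i = fact j / (fact i * fact m) * pochhammer (p + real i + 1) m * v ^ i *
       ((-1) ^ l * real (m choose l) /
         (pochhammer (c i + real l) l * pochhammer (c i + 2 * real l + 1) (m - l)))"
      if l: "l \<le> m" for l
    proof -
      have "real (i + l) + p + q + 1 + real r \<noteq> 0" if "r < i + l" for r
      proof -
        have "real (i + l) + p + q + 1 + real r = p + q + 1 + real (i + l + r)"
          by simp
        also have "\<dots> \<noteq> 0"
          using that l i by (intro pq) (auto simp: m_def)
        finally show ?thesis .
      qed
      then have nz: "pochhammer (real (i + l) + p + q + 1) (i + l) \<noteq> 0"
        by (rule pochhammer_neq_0I)
      have split: "pochhammer (real (i + l) + p + q + 1) (i + l) =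
          pochhammer (real (i + l) + p + q + 1) i * pochhammer (c i + real l) l"
        unfolding pochhammer_product' by (simp add: c_def algebra_simps)
      have frac: "pochhammer (real (i + l) + p + q + 1) i / pochhammer (real (i + l) + p + q + 1) (i + l) =
          1 / pochhammer (c i + real l) l"
        using nz unfolding split by simp
      have p: "pochhammer (p + real i + 1) m =
          pochhammer (p + real i + 1) l * pochhammer (p + real (i + l) + 1) (m - l)"
        using pochhammer_product[OF l, of "p + real i + 1"] by (simp add: algebra_simps)
      have b: "real (m choose l) / fact m = 1 / (fact l * fact (m - l))"
        unfolding binomial_fact[OF l] by simp
      have e: "2 * real (i + l) + p + q + 2 = c i + 2 * real l + 1" "j - (i + l) = m - l"
        by (simp_all add: c_def m_def algebra_simps)
      have "f (i + l) i = (-1) ^ l * fact j / fact i * pochhammer (p + real i + 1) m * v ^ i *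
         (1 / (fact l * fact (m - l))) *
         (pochhammer (real (i + l) + p + q + 1) i / pochhammer (real (i + l) + p + q + 1) (i + l)) /
         pochhammer (c i + 2 * real l + 1) (m - l)"
        unfolding f_def p e by (simp add: power_add mult_ac)
      then show ?thesis
        unfolding frac b[symmetric] by (simp add: mult_ac)
    qed
    then have "(\<Sum>l\<le>m. f (i + l) i) =
      fact j / (fact i * fact m) * pochhammer (p + real i + 1) m * v ^ i *
       (\<Sum>l\<le>m. (-1) ^ l * real (m choose l) /
         (pochhammer (c i + real l) l * pochhammer (c i + 2 * real l + 1) (m - l)))"
      unfolding sum_distrib_left by (intro sum.cong) auto
    moreover have "(\<Sum>l\<le>m. (-1) ^ l * real (m choose l) /
         (pochhammer (c i + real l) l * pochhammer (c i + 2 * real l + 1) (m - l))) = 0" if "i \<noteq> j"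
    proof (rule alternating_pochhammer_sum_eq_0)
      show "m > 0" using that i by (simp add: m_def)
      show "c i + real r \<noteq> 0" if "1 \<le> r" "r < 2 * m" for r
        using pq[of "2 * i + r"] that i by (simp add: c_def m_def algebra_simps)
    qed
    ultimately show "(\<Sum>l\<le>j - i. f (i + l) i) = (if i = j then v ^ j else 0)"
      by (auto simp: m_def)
  qed
  finally show ?thesis by (simp add: v_def)
qed

section \<open>The connection formula and the six-parameter polynomials\<close>

text \<open>
  Composition of the two expansions. With \<open>j = k + i\<close>, each Pochhammer symbol in
  the product of their coefficients splits into a part independent of \<open>i\<close> and a
  Pochhammer symbol of length \<open>i\<close> of the hypergeometric series; the factor
  \<open>(-1)^i / (n - k - i)!\<close> yields the numerator parameter \<open>k - n\<close>.
\<close>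
lemma jacobi_connection:
  assumes t: "-1 < t" "t < 1"
    and pq': "\<And>k. k \<le> n \<Longrightarrow> pochhammer (real k + p' + q' + 1) k \<noteq> 0"
    and p: "\<And>k. k \<le> n \<Longrightarrow> pochhammer (real k + p + 1) (n - k) \<noteq> 0"
  shows "jacobi n p q t = (\<Sum>k = 0..n.
    pochhammer (real k + p + 1) (n - k) * pochhammer (real n + p + q + 1) k /
    (fact (n - k) * pochhammer (real k + p' + q' + 1) k) *
    hyp3F2 (n - k) (real n + real k + p + q + 1) (real k + p' + 1)
      (2 * real k + p' + q' + 2) (real k + p + 1) *
    jacobi k p' q' t)"
proof -
  have nz: "p' + q' + 1 + real s \<noteq> 0" if "1 \<le> s" "s < 2 * n" for s
  proof -
    \<comment> \<open>The symbol \<open>(k + p' + q' + 1)_k\<close> has the factors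
      \<open>p' + q' + 1 + s\<close> for \<open>k \<le> s < 2 k\<close>; these ranges cover all
      \<open>s\<close> with \<open>1 \<le> s < 2 n\<close>.\<close>
    define k where "k = min s n"
    have "k \<le> n" "k \<le> s" "s - k < k" using that by (auto simp: k_def)
    with pq'[of k] have "real k + p' + q' + 1 + real (s - k) \<noteq> 0"
      by (force simp: pochhammer_prod simp del: of_nat_diff)
    with \<open>k \<le> s\<close> show ?thesis by (simp add: of_nat_diff algebra_simps)
  qed
  define a where "a j = pochhammer (p + real j + 1) (n - j) *
    pochhammer (real n + p + q + 1) j / (fact j * fact (n - j)) * (-1) ^ j" for j
  define d where "d j k = (-1) ^ k * fact j * pochhammer (p' + real k + 1) (j - k) /
    (fact (j - k) * pochhammer (real k + p' + q' + 1) k * pochhammer (2 * real k + p' + q' + 2) (j - k))" for j k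
  have "jacobi n p q t = (\<Sum>j\<le>n. a j * ((1 - t) / 2) ^ j)"
    unfolding jacobi_expansion[OF t] a_def ..
  also have "\<dots> = (\<Sum>j\<le>n. \<Sum>k\<le>j. a j * d j k * jacobi k p' q' t)"
  proof (intro sum.cong refl)
    fix j assume "j \<in> {..n}"
    then have "((1 - t) / 2) ^ j = (\<Sum>k\<le>j. d j k * jacobi k p' q' t)"
      unfolding d_def by (intro power_eq_sum_jacobi t nz) auto
    then show "a j * ((1 - t) / 2) ^ j = (\<Sum>k\<le>j. a j * d j k * jacobi k p' q' t)"
      by (simp add: sum_distrib_left mult.assoc)
  qed
  also have "\<dots> = (\<Sum>k\<le>n. \<Sum>i\<le>n - k. a (k + i) * d (k + i) k * jacobi k p' q' t)"
    by (rule sum_triangle_swap)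
  also have "\<dots> = (\<Sum>k\<le>n. pochhammer (real k + p + 1) (n - k) * pochhammer (real n + p + q + 1) k /
    (fact (n - k) * pochhammer (real k + p' + q' + 1) k) *
    hyp3F2 (n - k) (real n + real k + p + q + 1) (real k + p' + 1)
      (2 * real k + p' + q' + 2) (real k + p + 1) *
    jacobi k p' q' t)"
  proof (intro sum.cong refl)
    fix k assume "k \<in> {..n}"
    then have k: "k \<le> n" by simp
    have "a (k + i) * d (k + i) k = pochhammer (real k + p + 1) (n - k) * pochhammer (real n + p + q + 1) k /
      (fact (n - k) * pochhammer (real k + p' + q' + 1) k) *
      (pochhammer (- real (n - k)) i * pochhammer (real n + real k + p + q + 1) i *
        pochhammer (real k + p' + 1) i /
       (pochhammer (2 * real k + p' + q' + 2) i * pochhammer (real k + p + 1) i * fact i))"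
      if i: "i \<le> n - k" for i
    proof -
      have p1: "pochhammer (real k + p + 1) (n - k) =
          pochhammer (real k + p + 1) i * pochhammer (p + real (k + i) + 1) (n - (k + i))"
        using pochhammer_product[OF i, of "real k + p + 1"] by (simp add: algebra_simps)
      then have "pochhammer (real k + p + 1) i \<noteq> 0" using p[OF k] by auto
      then have p2: "pochhammer (p + real (k + i) + 1) (n - (k + i)) =
          pochhammer (real k + p + 1) (n - k) / pochhammer (real k + p + 1) i"
        unfolding p1 by simp
      have p3: "pochhammer (real n + p + q + 1) (k + i) =
          pochhammer (real n + p + q + 1) k * pochhammer (real n + real k + p + q + 1) i"
        unfolding pochhammer_product' by (simp add: algebra_simps)
      have "pochhammer (- real (n - k)) i = (-1) ^ i * (fact i * (real (n - k) gchoose i))"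
        by (simp add: gbinomial_pochhammer)
      also have "real (n - k) gchoose i = fact (n - k) / (fact i * fact (n - (k + i)))"
        using binomial_fact[OF i, where ?'a = real] by (simp add: binomial_gbinomial)
      finally have p4: "(-1) ^ i / fact (n - (k + i)) = pochhammer (- real (n - k)) i / fact (n - k)"
        by simp
      have "a (k + i) * d (k + i) k =
        (pochhammer (p + real (k + i) + 1) (n - (k + i))) * pochhammer (real n + p + q + 1) (k + i) *
        ((-1) ^ i / fact (n - (k + i))) * pochhammer (real k + p' + 1) i /
        (fact i * pochhammer (real k + p' + q' + 1) k * pochhammer (2 * real k + p' + q' + 2) i)"
        unfolding a_def d_def by (simp add: power_add mult_ac add_ac)
      also have "\<dots> = pochhammer (real k + p + 1) (n - k) * pochhammer (real n + p + q + 1) k /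
      (fact (n - k) * pochhammer (real k + p' + q' + 1) k) *
      (pochhammer (- real (n - k)) i * pochhammer (real n + real k + p + q + 1) i *
        pochhammer (real k + p' + 1) i /
       (pochhammer (2 * real k + p' + q' + 2) i * pochhammer (real k + p + 1) i * fact i))"
        unfolding p2 p3 p4 by (simp add: mult_ac)
      finally show ?thesis .
    qed
    then show "(\<Sum>i\<le>n - k. a (k + i) * d (k + i) k * jacobi k p' q' t) =
     pochhammer (real k + p + 1) (n - k) * pochhammer (real n + p + q + 1) k /
    (fact (n - k) * pochhammer (real k + p' + q' + 1) k) *
    hyp3F2 (n - k) (real n + real k + p + q + 1) (real k + p' + 1)
      (2 * real k + p' + q' + 2) (real k + p + 1) *
    jacobi k p' q' t"
      unfolding hyp3F2_def sum_distrib_left sum_distrib_right atLeast0AtMost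
      by (intro sum.cong) auto
  qed
  finally show ?thesis by (simp add: atLeast0AtMost)
qed

theorem theorem4:
  fixes n1 n2 n3 :: nat
    and \<alpha> \<beta> \<gamma> \<delta> a b \<phi> \<theta> \<eta> \<xi> e x y z :: real
  assumes e: "e = \<alpha> + \<beta> + \<gamma> + \<delta> + a + b"
    and xyz: "(x, y, z) \<in> simplex3"
    and den_C: "\<And>k1 k2 k3. k1 \<le> n1 \<Longrightarrow> k2 \<le> n2 \<Longrightarrow> k3 \<le> n3 \<Longrightarrow>
      pochhammer (real k1 + 2 * real k2 + 2 * real k3 + \<phi> + \<theta> + \<xi> + \<eta> + a + b + 3) k1 \<noteq> 0 \<and>
      pochhammer (real k2 + 2 * real k3 + \<theta> + \<xi> + \<eta> + b + 2) k2 \<noteq> 0 \<and>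
      pochhammer (real k3 + \<xi> + \<eta> + 1) k3 \<noteq> 0"
    and den_F1: "\<And>k1 k2 k3 j. k1 \<le> n1 \<Longrightarrow> k2 \<le> n2 \<Longrightarrow> k3 \<le> n3 \<Longrightarrow> j \<le> n1 - k1 \<Longrightarrow>
      pochhammer (2 * real k1 + 2 * real k2 + 2 * real k3 + \<phi> + \<theta> + \<xi> + \<eta> + a + b + 4) j \<noteq> 0 \<and>
      pochhammer (real k1 + 2 * real n2 + 2 * real n3 + \<beta> + \<gamma> + \<delta> + a + b + 3) j \<noteq> 0"
    and den_F2: "\<And>k2 k3 j. k2 \<le> n2 \<Longrightarrow> k3 \<le> n3 \<Longrightarrow> j \<le> n2 - k2 \<Longrightarrow>
      pochhammer (2 * real k2 + 2 * real k3 + \<theta> + \<xi> + \<eta> + b + 3) j \<noteq> 0 \<and>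
      pochhammer (real k2 + 2 * real n3 + \<gamma> + \<delta> + b + 2) j \<noteq> 0"
    and den_F3: "\<And>k3 j. k3 \<le> n3 \<Longrightarrow> j \<le> n3 - k3 \<Longrightarrow>
      pochhammer (2 * real k3 + \<xi> + \<eta> + 2) j \<noteq> 0 \<and>
      pochhammer (real k3 + \<delta> + 1) j \<noteq> 0"
  shows "simplex_poly n1 n2 n3 \<alpha> \<beta> \<gamma> \<delta> a b x y z =
    (\<Sum>k1 = 0..n1. \<Sum>k2 = 0..n2. \<Sum>k3 = 0..n3.
      (pochhammer (real k1 + 2 * real n2 + 2 * real n3 + \<beta> + \<gamma> + \<delta> + a + b + 3) (n1 - k1) *
       pochhammer (real n1 + 2 * real n2 + 2 * real n3 + e + 3) k1 /
       (fact (n1 - k1) * fact (n2 - k2) * fact (n3 - k3) *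
        pochhammer (real k1 + 2 * real k2 + 2 * real k3 + \<phi> + \<theta> + \<xi> + \<eta> + a + b + 3) k1) *
       (pochhammer (real k2 + 2 * real n3 + \<gamma> + \<delta> + b + 2) (n2 - k2) *
        pochhammer (real n2 + 2 * real n3 + \<beta> + \<gamma> + \<delta> + b + 2) k2 *
        pochhammer (real k3 + \<delta> + 1) (n3 - k3) *
        pochhammer (real n3 + \<gamma> + \<delta> + 1) k3 /
        (pochhammer (real k2 + 2 * real k3 + \<theta> + \<xi> + \<eta> + b + 2) k2 *
         pochhammer (real k3 + \<xi> + \<eta> + 1) k3))) *
      hyp3F2 (n1 - k1)
        (real n1 + 2 * real n2 + 2 * real n3 + real k1 + e + 3)
        (real k1 + 2 * real k2 + 2 * real k3 + \<theta> + \<xi> + \<eta> + a + b + 3)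
        (2 * real k1 + 2 * real k2 + 2 * real k3 + \<phi> + \<theta> + \<xi> + \<eta> + a + b + 4)
        (real k1 + 2 * real n2 + 2 * real n3 + \<beta> + \<gamma> + \<delta> + a + b + 3) *
      hyp3F2 (n2 - k2)
        (real n2 + 2 * real n3 + real k2 + \<beta> + \<gamma> + \<delta> + b + 2)
        (real k2 + 2 * real k3 + \<xi> + \<eta> + b + 2)
        (2 * real k2 + 2 * real k3 + \<theta> + \<xi> + \<eta> + b + 3)
        (real k2 + 2 * real n3 + \<gamma> + \<delta> + b + 2) *
      hyp3F2 (n3 - k3)
        (real n3 + real k3 + \<gamma> + \<delta> + 1)
        (real k3 + \<xi> + 1)
        (2 * real k3 + \<xi> + \<eta> + 2)
        (real k3 + \<delta> + 1) *
      (1 - x) ^ (n2 - k2) * (1 - x - y) ^ (n3 - k3) *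
      simplex_poly k1 k2 k3 \<phi> \<theta> \<eta> \<xi> a b x y z)"
proof -
  define u where "u = 1 - x"
  define w where "w = 1 - x - y"
  define J1 where "J1 = jacobi n1 (\<beta> + \<gamma> + \<delta> + a + b + 2 * real n2 + 2 * real n3 + 2) \<alpha> (2 * x - 1)"
  define J2 where "J2 = jacobi n2 (\<gamma> + \<delta> + 2 * real n3 + b + 1) \<beta> (2 * y / u - 1)"
  define J3 where "J3 = jacobi n3 \<delta> \<gamma> (2 * z / w - 1)"
  define j1 where "j1 k1 k2 k3 =
    jacobi k1 (\<theta> + \<eta> + \<xi> + a + b + 2 * real k2 + 2 * real k3 + 2) \<phi> (2 * x - 1)" for k1 k2 k3 :: nat
  define j2 where "j2 k2 k3 = jacobi k2 (\<eta> + \<xi> + 2 * real k3 + b + 1) \<theta> (2 * y / u - 1)" for k2 k3 :: nat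
  define j3 where "j3 k3 = jacobi k3 \<xi> \<eta> (2 * z / w - 1)" for k3
  define h1 where "h1 k1 k2 k3 = hyp3F2 (n1 - k1)
        (real n1 + 2 * real n2 + 2 * real n3 + real k1 + e + 3)
        (real k1 + 2 * real k2 + 2 * real k3 + \<theta> + \<xi> + \<eta> + a + b + 3)
        (2 * real k1 + 2 * real k2 + 2 * real k3 + \<phi> + \<theta> + \<xi> + \<eta> + a + b + 4)
        (real k1 + 2 * real n2 + 2 * real n3 + \<beta> + \<gamma> + \<delta> + a + b + 3)" for k1 k2 k3
  define h2 where "h2 k2 k3 = hyp3F2 (n2 - k2)
        (real n2 + 2 * real n3 + real k2 + \<beta> + \<gamma> + \<delta> + b + 2)
        (real k2 + 2 * real k3 + \<xi> + \<eta> + b + 2)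
        (2 * real k2 + 2 * real k3 + \<theta> + \<xi> + \<eta> + b + 3)
        (real k2 + 2 * real n3 + \<gamma> + \<delta> + b + 2)" for k2 k3
  define h3 where "h3 k3 = hyp3F2 (n3 - k3)
        (real n3 + real k3 + \<gamma> + \<delta> + 1)
        (real k3 + \<xi> + 1)
        (2 * real k3 + \<xi> + \<eta> + 2)
        (real k3 + \<delta> + 1)" for k3
  define c1 where "c1 k1 k2 k3 =
    pochhammer (real k1 + 2 * real n2 + 2 * real n3 + \<beta> + \<gamma> + \<delta> + a + b + 3) (n1 - k1) *
    pochhammer (real n1 + 2 * real n2 + 2 * real n3 + e + 3) k1 /
    (fact (n1 - k1) *
     pochhammer (real k1 + 2 * real k2 + 2 * real k3 + \<phi> + \<theta> + \<xi> + \<eta> + a + b + 3) k1)"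
    for k1 k2 k3 :: nat
  define c2 where "c2 k2 k3 =
    pochhammer (real k2 + 2 * real n3 + \<gamma> + \<delta> + b + 2) (n2 - k2) *
    pochhammer (real n2 + 2 * real n3 + \<beta> + \<gamma> + \<delta> + b + 2) k2 /
    (fact (n2 - k2) * pochhammer (real k2 + 2 * real k3 + \<theta> + \<xi> + \<eta> + b + 2) k2)"
    for k2 k3 :: nat
  define c3 where "c3 k3 =
    pochhammer (real k3 + \<delta> + 1) (n3 - k3) * pochhammer (real n3 + \<gamma> + \<delta> + 1) k3 /
    (fact (n3 - k3) * pochhammer (real k3 + \<xi> + \<eta> + 1) k3)" for k3

  have pos: "0 < x" "0 < y" "0 < z" "z < w" "y < u" "x < 1"
    using xyz by (auto simp: simplex3_def u_def w_def)
  have t1: "-1 < 2 * x - 1" "2 * x - 1 < 1"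
    using pos by auto
  have t2: "-1 < 2 * y / u - 1" "2 * y / u - 1 < 1"
    using pos by (auto simp: field_simps)
  have t3: "-1 < 2 * z / w - 1" "2 * z / w - 1 < 1"
    using pos by (auto simp: field_simps)

  have C1: "J1 = (\<Sum>k1 = 0..n1. c1 k1 k2 k3 * h1 k1 k2 k3 * j1 k1 k2 k3)"
    if k: "k2 \<le> n2" "k3 \<le> n3" for k2 k3
  proof -
    define p where "p = \<beta> + \<gamma> + \<delta> + a + b + 2 * real n2 + 2 * real n3 + 2"
    define p' where "p' = \<theta> + \<eta> + \<xi> + a + b + 2 * real k2 + 2 * real k3 + 2"
    have eqs:
      "real k1 + 2 * real n2 + 2 * real n3 + \<beta> + \<gamma> + \<delta> + a + b + 3 = real k1 + p + 1"
      "real n1 + 2 * real n2 + 2 * real n3 + e + 3 = real n1 + p + \<alpha> + 1"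
      "real n1 + 2 * real n2 + 2 * real n3 + real k1 + e + 3 = real n1 + real k1 + p + \<alpha> + 1"
      "real k1 + 2 * real k2 + 2 * real k3 + \<phi> + \<theta> + \<xi> + \<eta> + a + b + 3 = real k1 + p' + \<phi> + 1"
      "real k1 + 2 * real k2 + 2 * real k3 + \<theta> + \<xi> + \<eta> + a + b + 3 = real k1 + p' + 1"
      "2 * real k1 + 2 * real k2 + 2 * real k3 + \<phi> + \<theta> + \<xi> + \<eta> + a + b + 4 =
         2 * real k1 + p' + \<phi> + 2" for k1
      by (simp_all add: p_def p'_def e)
    show ?thesis
      unfolding J1_def j1_def c1_def h1_def p_def[symmetric] p'_def[symmetric] eqs
    proof (rule jacobi_connection[OF t1])
      show "pochhammer (real k1 + p' + \<phi> + 1) k1 \<noteq> 0" if "k1 \<le> n1" for k1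
        using den_C[OF that k] unfolding eqs by blast
      show "pochhammer (real k1 + p + 1) (n1 - k1) \<noteq> 0" if "k1 \<le> n1" for k1
        using den_F1[OF that k order_refl] unfolding eqs by blast
    qed
  qed
  have C2: "J2 = (\<Sum>k2 = 0..n2. c2 k2 k3 * h2 k2 k3 * j2 k2 k3)" if k: "k3 \<le> n3" for k3
  proof -
    define p where "p = \<gamma> + \<delta> + 2 * real n3 + b + 1"
    define p' where "p' = \<eta> + \<xi> + 2 * real k3 + b + 1"
    have eqs:
      "real k2 + 2 * real n3 + \<gamma> + \<delta> + b + 2 = real k2 + p + 1"
      "real n2 + 2 * real n3 + \<beta> + \<gamma> + \<delta> + b + 2 = real n2 + p + \<beta> + 1"
      "real n2 + 2 * real n3 + real k2 + \<beta> + \<gamma> + \<delta> + b + 2 = real n2 + real k2 + p + \<beta> + 1"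
      "real k2 + 2 * real k3 + \<theta> + \<xi> + \<eta> + b + 2 = real k2 + p' + \<theta> + 1"
      "real k2 + 2 * real k3 + \<xi> + \<eta> + b + 2 = real k2 + p' + 1"
      "2 * real k2 + 2 * real k3 + \<theta> + \<xi> + \<eta> + b + 3 = 2 * real k2 + p' + \<theta> + 2" for k2
      by (simp_all add: p_def p'_def)
    show ?thesis
      unfolding J2_def j2_def c2_def h2_def p_def[symmetric] p'_def[symmetric] eqs
    proof (rule jacobi_connection[OF t2])
      show "pochhammer (real k2 + p' + \<theta> + 1) k2 \<noteq> 0" if "k2 \<le> n2" for k2
        using den_C[OF le0 that k] unfolding eqs by blast
      show "pochhammer (real k2 + p + 1) (n2 - k2) \<noteq> 0" if "k2 \<le> n2" for k2
        using den_F2[OF that k order_refl] unfolding eqs by blast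
    qed
  qed
  have C3: "J3 = (\<Sum>k3 = 0..n3. c3 k3 * h3 k3 * j3 k3)"
  proof -
    have eqs:
      "real n3 + \<gamma> + \<delta> + 1 = real n3 + \<delta> + \<gamma> + 1"
      "real n3 + real k3 + \<gamma> + \<delta> + 1 = real n3 + real k3 + \<delta> + \<gamma> + 1" for k3
      by simp_all
    show ?thesis
      unfolding J3_def j3_def c3_def h3_def eqs
      using den_C[OF le0 le0] den_F3[OF _ order_refl] by (intro jacobi_connection[OF t3]) blast+
  qed

  have "J3 * (J2 * J1) = (\<Sum>k3 = 0..n3. c3 k3 * h3 k3 * j3 k3 * (J2 * J1))"
    unfolding C3 by (rule sum_distrib_right)
  also have "\<dots> = (\<Sum>k3 = 0..n3. \<Sum>k2 = 0..n2. \<Sum>k1 = 0..n1.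
    (c3 k3 * h3 k3 * j3 k3) * ((c2 k2 k3 * h2 k2 k3 * j2 k2 k3) * (c1 k1 k2 k3 * h1 k1 k2 k3 * j1 k1 k2 k3)))"
  proof (intro sum.cong refl)
    fix k3 assume "k3 \<in> {0..n3}"
    then have k3: "k3 \<le> n3" by simp
    have "J2 * J1 = (\<Sum>k2 = 0..n2. (c2 k2 k3 * h2 k2 k3 * j2 k2 k3) * J1)"
      unfolding C2[OF k3] by (rule sum_distrib_right)
    also have "\<dots> = (\<Sum>k2 = 0..n2. \<Sum>k1 = 0..n1.
      (c2 k2 k3 * h2 k2 k3 * j2 k2 k3) * (c1 k1 k2 k3 * h1 k1 k2 k3 * j1 k1 k2 k3))"
      unfolding sum_distrib_left[symmetric] using k3 by (intro sum.cong) (simp_all flip: C1)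
    finally show "c3 k3 * h3 k3 * j3 k3 * (J2 * J1) = (\<Sum>k2 = 0..n2. \<Sum>k1 = 0..n1.
      (c3 k3 * h3 k3 * j3 k3) * ((c2 k2 k3 * h2 k2 k3 * j2 k2 k3) * (c1 k1 k2 k3 * h1 k1 k2 k3 * j1 k1 k2 k3)))"
      by (simp add: sum_distrib_left)
  qed
  also have "\<dots> = (\<Sum>k2 = 0..n2. \<Sum>k3 = 0..n3. \<Sum>k1 = 0..n1.
    (c3 k3 * h3 k3 * j3 k3) * ((c2 k2 k3 * h2 k2 k3 * j2 k2 k3) * (c1 k1 k2 k3 * h1 k1 k2 k3 * j1 k1 k2 k3)))"
    by (rule sum.swap)
  also have "\<dots> = (\<Sum>k2 = 0..n2. \<Sum>k1 = 0..n1. \<Sum>k3 = 0..n3.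
    (c3 k3 * h3 k3 * j3 k3) * ((c2 k2 k3 * h2 k2 k3 * j2 k2 k3) * (c1 k1 k2 k3 * h1 k1 k2 k3 * j1 k1 k2 k3)))"
    by (rule sum.cong[OF refl sum.swap])
  also have "\<dots> = (\<Sum>k1 = 0..n1. \<Sum>k2 = 0..n2. \<Sum>k3 = 0..n3.
    (c3 k3 * h3 k3 * j3 k3) * ((c2 k2 k3 * h2 k2 k3 * j2 k2 k3) * (c1 k1 k2 k3 * h1 k1 k2 k3 * j1 k1 k2 k3)))"
    by (rule sum.swap)
  finally have prod: "J3 * (J2 * J1) = \<dots>" .
  have "simplex_poly n1 n2 n3 \<alpha> \<beta> \<gamma> \<delta> a b x y z = u ^ n2 * w ^ n3 * (J3 * (J2 * J1))"
    by (simp add: simplex_poly_def J1_def J2_def J3_def u_def w_def)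
  also have "\<dots> = (\<Sum>k1 = 0..n1. \<Sum>k2 = 0..n2. \<Sum>k3 = 0..n3. u ^ n2 * w ^ n3 *
    ((c3 k3 * h3 k3 * j3 k3) * ((c2 k2 k3 * h2 k2 k3 * j2 k2 k3) * (c1 k1 k2 k3 * h1 k1 k2 k3 * j1 k1 k2 k3))))"
    unfolding prod sum_distrib_left ..
  finally show ?thesis
    unfolding h1_def[symmetric] h2_def[symmetric] h3_def[symmetric] w_def[symmetric]
    unfolding u_def[symmetric]
  proof (rule trans, intro sum.cong refl)
    fix k1 k2 k3
    assume "k2 \<in> {0..n2}" "k3 \<in> {0..n3}"
    then have pow: "u ^ n2 = u ^ (n2 - k2) * u ^ k2" "w ^ n3 = w ^ (n3 - k3) * w ^ k3"
      by (simp_all flip: power_add)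
    have poly: "simplex_poly k1 k2 k3 \<phi> \<theta> \<eta> \<xi> a b x y z =
        j1 k1 k2 k3 * u ^ k2 * j2 k2 k3 * w ^ k3 * j3 k3"
      by (simp add: simplex_poly_def j1_def j2_def j3_def u_def w_def)
    show "u ^ n2 * w ^ n3 *
    ((c3 k3 * h3 k3 * j3 k3) * ((c2 k2 k3 * h2 k2 k3 * j2 k2 k3) * (c1 k1 k2 k3 * h1 k1 k2 k3 * j1 k1 k2 k3))) =
      (pochhammer (real k1 + 2 * real n2 + 2 * real n3 + \<beta> + \<gamma> + \<delta> + a + b + 3) (n1 - k1) *
       pochhammer (real n1 + 2 * real n2 + 2 * real n3 + e + 3) k1 /
       (fact (n1 - k1) * fact (n2 - k2) * fact (n3 - k3) *
        pochhammer (real k1 + 2 * real k2 + 2 * real k3 + \<phi> + \<theta> + \<xi> + \<eta> + a + b + 3) k1) *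
       (pochhammer (real k2 + 2 * real n3 + \<gamma> + \<delta> + b + 2) (n2 - k2) *
        pochhammer (real n2 + 2 * real n3 + \<beta> + \<gamma> + \<delta> + b + 2) k2 *
        pochhammer (real k3 + \<delta> + 1) (n3 - k3) *
        pochhammer (real n3 + \<gamma> + \<delta> + 1) k3 /
        (pochhammer (real k2 + 2 * real k3 + \<theta> + \<xi> + \<eta> + b + 2) k2 *
         pochhammer (real k3 + \<xi> + \<eta> + 1) k3))) *
      h1 k1 k2 k3 * h2 k2 k3 * h3 k3 * u ^ (n2 - k2) * w ^ (n3 - k3) *
      simplex_poly k1 k2 k3 \<phi> \<theta> \<eta> \<xi> a b x y z"
      unfolding poly pow c1_def c2_def c3_def by (simp add: mult_ac)
  qed
qed

end
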